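(* The limit $\overline K=\lim_{n\to\infty}\frac{\overline K(n)}{n}$ exists, is equal to $\inf_{n\ge 1}\frac{\overline K(n)}{n}$, and satisfies \[0.08781<\overline K\le \frac{\overline K(21)}{21}=\frac{372487}{7\cdot 2^{18}}\approx 0.2030 .\]
   Context: Words are finite strings over the two-letter alphabet $\{a,b\}$; the length of a word $w$ is $l(w)$. A word $w=a_0\dots a_n$ is a palindrome if $a_i=a_{n-i}$ for all $i\le n$. For a nonempty word $w$, $m(w)$ is the minimal number $k$ such that $w=p_1\cdots p_k$ (concatenation) with $p_1,\dots,p_k$ nonempty palindromes. For a positive integer $n$, $\overline K(n)=2^{-n}\sum\{m(w): l(w)=n\}$, the average of $m(w)$ over all $2^n$ binary words of length $n$. *)

theory Defs
  imports "HOL-Analysis.Analysis"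
begin

datatype letter = Letter_a | Letter_b

type_synonym word = "letter list"

definition palindrome :: "word \<Rightarrow> bool" where
  "palindrome w \<longleftrightarrow> (\<forall>i < length w. w ! i = w ! (length w - 1 - i))"

definition palindromic_factorization :: "word \<Rightarrow> word list \<Rightarrow> bool" where
  "palindromic_factorization w ps \<longleftrightarrow>
     concat ps = w \<and> (\<forall>p \<in> set ps. p \<noteq> [] \<and> palindrome p)"

definition pal_width :: "word \<Rightarrow> nat" where
  "pal_width w = (LEAST k. \<exists>ps. length ps = k \<and> palindromic_factorization w ps)"

definition Kbar :: "nat \<Rightarrow> real" where
  "Kbar n = (\<Sum>w | length w = n. real (pal_width w)) / 2 ^ n"

end

theory Submission
  imports Defs
begin

text \<open>
  Concatenating factorizations shows that \<open>Kbar\<close> is subadditive, so the limit exists and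
  equals the infimum by Fekete's lemma.

  For the lower bound, removing the first palindrome of an optimal factorization shows that
  \<open>S n = (\<Sum>w | length w = n. \<theta> ^ pal_width w)\<close> satisfies
  \<open>S n \<le> (\<Sum>j = 1..n. 2 ^ \<lceil>j / 2\<rceil> * \<theta> * S (n - j))\<close>, since there are \<open>2 ^ \<lceil>j / 2\<rceil>\<close>
  palindromes of length \<open>j\<close>. If \<open>\<theta>\<close> is the reciprocal of
  \<open>(\<Sum>j. 2 ^ \<lceil>j / 2\<rceil> * x ^ j) = 2 * x * (1 + x) / (1 - 2 * x\<^sup>2)\<close>, then \<open>S n \<le> x powi (- n)\<close>, and
  convexity of the exponential function gives \<open>\<theta> powr Kbar n \<le> (2 * x) powi (- n)\<close>. The choice
  \<open>x = 3 / 5\<close>, \<open>\<theta> = 7 / 48\<close> yields \<open>Kbar n \<ge> 9 / 100 * n\<close>.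

  The value of \<open>Kbar 21\<close> is computed by the simplifier, which walks through the tree of all words
  that end in a fixed letter. Words grow at the front, and for every palindromic prefix of the
  current word the remaining suffix is kept together with the widths of all its own suffixes.
  This suffices to find the palindromic prefixes and the width of every one-letter extension.
\<close>

section \<open>Palindromic width\<close>

lemma palindrome_nth:
  "palindrome w \<Longrightarrow> i < length w \<Longrightarrow> w ! i = w ! (length w - 1 - i)"
  unfolding palindrome_def by blast

lemma palindrome_iff_rev: "palindrome w \<longleftrightarrow> rev w = w"
proof
  assume "palindrome w"
  then have "rev w ! i = w ! i" if "i < length w" for i
    using palindrome_nth[of w i] that by (simp add: rev_nth)
  then show "rev w = w"
    by (intro nth_equalityI) simp_all
next
  assume "rev w = w"
  then have "w ! i = w ! (length w - 1 - i)" if "i < length w" for i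
    using rev_nth[OF that] by simp
  then show "palindrome w"
    unfolding palindrome_def by blast
qed

text \<open>Words grow at the front below, and peeling off both end letters relates the palindromic
  prefixes of \<open>c # w\<close> to those of \<open>w\<close>.\<close>

lemma palindrome_snoc_cases:
  assumes "palindrome p"
  obtains "p = []" | c where "p = [c]" | c q where "p = c # q @ [c]" "palindrome q"
proof (cases p)
  case (Cons c r)
  show thesis
  proof (cases r rule: rev_cases)
    case (snoc q d)
    have "d # rev q @ [c] = c # q @ [d]"
      using assms unfolding Cons snoc palindrome_iff_rev
      by (simp only: rev.simps rev_append append.simps)
    then have "d = c" "rev q = q"
      unfolding list.inject append1_eq_conv by blast+
    then show thesis
      using Cons snoc by (intro that(3)[of c q]) (simp_all only: palindrome_iff_rev)
  next
    case Nil
    with Cons show thesis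
      by (intro that(2)[of c]) (simp only:)
  qed
qed (rule that(1))

lemma palindromic_factorization_singletons:
  "palindromic_factorization w (map (\<lambda>c. [c]) w)"
  by (induction w) (auto simp: palindromic_factorization_def palindrome_def)

lemma pal_width_le:
  "palindromic_factorization w ps \<Longrightarrow> pal_width w \<le> length ps"
  unfolding pal_width_def by (rule Least_le) blast

lemma pal_width_factorization:
  obtains ps where "length ps = pal_width w" "palindromic_factorization w ps"
proof -
  have "\<exists>ps. length ps = pal_width w \<and> palindromic_factorization w ps"
    unfolding pal_width_def
    by (rule LeastI_ex) (use palindromic_factorization_singletons in blast)
  with that show thesis
    by blast
qed

lemma pal_width_Nil [simp]: "pal_width [] = 0"
  using pal_width_le[of "[]" "[]"] by (simp add: palindromic_factorization_def)

lemma pal_width_append_le: "pal_width (u @ v) \<le> pal_width u + pal_width v"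
proof -
  obtain ps where ps: "length ps = pal_width u" "palindromic_factorization u ps"
    by (rule pal_width_factorization)
  obtain qs where qs: "length qs = pal_width v" "palindromic_factorization v qs"
    by (rule pal_width_factorization)
  have "palindromic_factorization (u @ v) (ps @ qs)"
    using ps qs by (auto simp: palindromic_factorization_def)
  from pal_width_le[OF this] ps qs show ?thesis
    by simp
qed

lemma pal_width_palindrome_append_le:
  assumes "palindrome p" "p \<noteq> []"
  shows "pal_width (p @ w) \<le> Suc (pal_width w)"
proof -
  have "pal_width p \<le> 1"
    using pal_width_le[of p "[p]"] assms by (simp add: palindromic_factorization_def)
  with pal_width_append_le[of p w] show ?thesis
    by simp
qed

text \<open>A shorter factorization of the rest would shorten the optimal one of \<open>w\<close>,
  so cutting off its first palindrome lowers the width by exactly one.\<close>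

lemma pal_width_first_palindrome:
  assumes "w \<noteq> []"
  obtains p v where "w = p @ v" "p \<noteq> []" "palindrome p" "pal_width w = Suc (pal_width v)"
proof -
  obtain ps where ps: "length ps = pal_width w" "palindromic_factorization w ps"
    by (rule pal_width_factorization)
  with assms obtain p qs where ps_eq: "ps = p # qs"
    by (cases ps) (auto simp: palindromic_factorization_def)
  let ?v = "concat qs"
  have p: "w = p @ ?v" "p \<noteq> []" "palindrome p"
    using ps by (auto simp: ps_eq palindromic_factorization_def)
  have "pal_width ?v \<le> length qs"
    using ps by (intro pal_width_le) (auto simp: ps_eq palindromic_factorization_def)
  moreover have "pal_width w \<le> Suc (pal_width ?v)"
    using p pal_width_palindrome_append_le by metis
  ultimately have "pal_width w = Suc (pal_width ?v)"
    using ps by (simp add: ps_eq)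
  with p that show thesis
    by blast
qed

text \<open>Every letterwise map preserves palindromes. Applied twice, this gives invariance of the
  width under the letter swap.\<close>

lemma pal_width_map_le: "pal_width (map f w) \<le> pal_width w"
proof -
  obtain ps where ps: "length ps = pal_width w" "palindromic_factorization w ps"
    by (rule pal_width_factorization)
  have "palindromic_factorization (map f w) (map (map f) ps)"
    using ps by (auto simp: palindromic_factorization_def palindrome_iff_rev rev_map map_concat)
  from pal_width_le[OF this] ps show ?thesis
    by simp
qed

section \<open>Sums over words\<close>

lemma UNIV_letter: "UNIV = {Letter_a, Letter_b}"
proof (intro equalityI subsetI)
  fix c :: letter
  show "c \<in> {Letter_a, Letter_b}"
    by (cases c) auto
qed simp

lemma finite_words [simp]: "finite {w :: word. length w = n}"
proof -
  have "finite {w :: word. set w \<subseteq> UNIV \<and> length w = n}"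
    by (rule finite_lists_length_eq) (simp add: UNIV_letter)
  then show ?thesis
    by simp
qed

lemma card_words [simp]: "card {w :: word. length w = n} = 2 ^ n"
proof -
  have "card {w :: word. set w \<subseteq> UNIV \<and> length w = n} = card (UNIV :: letter set) ^ n"
    by (rule card_lists_length_eq) (simp add: UNIV_letter)
  moreover have "card (UNIV :: letter set) = 2"
    by (simp add: UNIV_letter)
  ultimately show ?thesis
    by simp
qed

lemma sum_words_append:
  fixes f :: "word \<Rightarrow> 'a :: comm_monoid_add"
  shows "(\<Sum>w | length w = m + n. f w) = (\<Sum>u | length u = m. \<Sum>v | length v = n. f (u @ v))"
proof -
  have "bij_betw (\<lambda>(u, v). u @ v) ({u. length u = m} \<times> {v. length v = n})
      {w :: word. length w = m + n}"
    by (rule bij_betw_byWitness[where f' = "\<lambda>w. (take m w, drop m w)"]) auto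
  from sum.reindex_bij_betw[OF this, of f] show ?thesis
    by (simp add: sum.cartesian_product case_prod_beta)
qed

lemma words_length_one: "{w :: word. length w = Suc 0} = {[Letter_a], [Letter_b]}"
proof (intro equalityI subsetI)
  fix w :: word
  assume "w \<in> {w. length w = Suc 0}"
  then obtain c where "w = [c]"
    by (auto simp: length_Suc_conv)
  then show "w \<in> {[Letter_a], [Letter_b]}"
    by (cases c) auto
qed auto

lemma sum_words_snoc:
  fixes f :: "word \<Rightarrow> 'a :: comm_monoid_add"
  shows "(\<Sum>w | length w = Suc n. f w) =
    (\<Sum>v | length v = n. f (v @ [Letter_a])) + (\<Sum>v | length v = n. f (v @ [Letter_b]))"
  using sum_words_append[of f n "Suc 0"] by (simp add: words_length_one sum.distrib)

section \<open>Subadditivity\<close>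

lemma Kbar_nonneg: "Kbar n \<ge> 0"
  by (simp add: Kbar_def sum_nonneg)

lemma Kbar_subadditive: "Kbar (m + n) \<le> Kbar m + Kbar n"
proof -
  have "(\<Sum>w | length w = m + n. real (pal_width w)) \<le>
      (\<Sum>u | length u = m. \<Sum>v | length v = n. real (pal_width u) + real (pal_width v))"
    unfolding sum_words_append
    by (intro sum_mono) (use pal_width_append_le in \<open>simp flip: of_nat_add\<close>)
  also have "\<dots> = 2 ^ n * (\<Sum>u | length u = m. real (pal_width u)) +
      2 ^ m * (\<Sum>v | length v = n. real (pal_width v))"
    by (simp add: sum.distrib sum_distrib_left)
  finally show ?thesis
    by (simp add: Kbar_def field_simps power_add)
qed

section \<open>Fekete's lemma\<close>

lemma subadditive_mult_add_le:
  fixes f :: "nat \<Rightarrow> real"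
  assumes "\<And>m n. f (m + n) \<le> f m + f n"
  shows "f (q * m + r) \<le> real q * f m + f r"
proof (induction q)
  case (Suc q)
  have "f (Suc q * m + r) \<le> f m + f (q * m + r)"
    using assms[of m "q * m + r"] by (simp add: add.assoc)
  with Suc show ?case
    by (simp add: algebra_simps)
qed simp

lemma Fekete:
  fixes f :: "nat \<Rightarrow> real"
  assumes subadd: "\<And>m n. f (m + n) \<le> f m + f n" and nonneg: "\<And>n. 0 \<le> f n"
  shows "(\<lambda>n. f n / real n) \<longlonglongrightarrow> (INF n\<in>{1..}. f n / real n)"
proof -
  let ?g = "\<lambda>n. f n / real n"
  define L where "L = (INF n\<in>{1..}. ?g n)"
  have bdd: "bdd_below (?g ` {1..})"
    using nonneg by (intro bdd_belowI2[of _ 0]) simp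
  have lower: "L \<le> ?g n" if "n \<ge> 1" for n
    unfolding L_def using bdd that by (intro cINF_lower) auto
  show ?thesis
    unfolding L_def[symmetric]
  proof (rule order_tendstoI)
    fix a assume "a < L"
    then show "\<forall>\<^sub>F n in sequentially. a < ?g n"
      using lower by (intro eventually_sequentiallyI[of 1]) fastforce
  next
    fix a assume "L < a"
    then obtain m where m: "m \<ge> 1" "?g m < a"
      unfolding L_def using bdd by (subst (asm) cINF_less_iff) auto
    \<comment> \<open>By nonnegativity this sum bounds \<open>f\<close> at every remainder modulo
      \<open>m\<close>, so the remainder costs only \<open>M / n\<close> after division by
      \<open>n\<close>.\<close>
    define M where "M = (\<Sum>r<m. f r)"
    have bound: "?g n \<le> ?g m + M / real n" if "n \<ge> 1" for n
    proof -
      have "f (n mod m) \<le> M"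
        unfolding M_def using m nonneg by (intro member_le_sum) auto
      moreover have "f n \<le> real (n div m) * f m + f (n mod m)"
        using subadditive_mult_add_le[OF subadd, of "n div m" m "n mod m"] by simp
      moreover have "real (n div m) * f m \<le> real n / real m * f m"
        using nonneg by (intro mult_right_mono of_nat_div_le_of_nat) auto
      ultimately have "f n \<le> real n / real m * f m + M"
        by linarith
      with that m show ?thesis
        by (simp add: field_simps)
    qed
    have "(\<lambda>n. ?g m + M / real n) \<longlonglongrightarrow> ?g m + 0"
      by (intro tendsto_intros lim_const_over_n)
    then have "\<forall>\<^sub>F n in sequentially. ?g m + M / real n < a"
      using m by (intro order_tendstoD(2)) auto
    then show "\<forall>\<^sub>F n in sequentially. ?g n < a"
      using eventually_ge_at_top[of 1]
      by eventually_elim (use bound in fastforce)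
  qed
qed

section \<open>Lower bound\<close>

text \<open>The first half, including the middle letter for odd \<open>n\<close>, determines a
  palindrome by reflection.\<close>

lemma card_palindromes_le:
  "card {p. length p = n \<and> palindrome p} \<le> 2 ^ ((n + 1) div 2)"
proof -
  let ?h = "(n + 1) div 2"
  have inj: "inj_on (take ?h) {p. length p = n \<and> palindrome p}"
  proof (rule inj_onI)
    fix p q :: word
    assume *: "p \<in> {p. length p = n \<and> palindrome p}" "q \<in> {p. length p = n \<and> palindrome p}"
      and eq: "take ?h p = take ?h q"
    have half: "p ! i = q ! i" if "i < ?h" for i
      using arg_cong[OF eq, of "\<lambda>u. u ! i"] that by simp
    show "p = q"
    proof (rule nth_equalityI)
      fix i assume "i < length p"
      show "p ! i = q ! i"
      proof (cases "i < ?h")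
        case False
        then have "p ! (n - 1 - i) = q ! (n - 1 - i)"
          using \<open>i < length p\<close> * by (intro half) auto
        with * \<open>i < length p\<close> palindrome_nth[of p i] palindrome_nth[of q i] show ?thesis
          by simp
      qed (rule half)
    qed (use * in simp)
  qed
  have "card {p. length p = n \<and> palindrome p} \<le> card {w :: word. length w = ?h}"
    by (rule card_inj_on_le[OF inj]) auto
  then show ?thesis
    by simp
qed

text \<open>This is \<open>S n\<close> of the overview, with \<open>t\<close> for \<theta>; the
  coefficient of \<open>t ^ k\<close> counts the words of width \<open>k\<close>.\<close>

definition width_gf :: "real \<Rightarrow> nat \<Rightarrow> real" where
  "width_gf t n = (\<Sum>w | length w = n. t ^ pal_width w)"

lemma width_gf_nonneg: "0 \<le> t \<Longrightarrow> 0 \<le> width_gf t n"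
  by (simp add: width_gf_def sum_nonneg)

lemma width_gf_le:
  assumes "0 \<le> t" "1 \<le> n"
  shows "width_gf t n \<le> (\<Sum>j=1..n. 2 ^ ((j + 1) div 2) * t * width_gf t (n - j))"
proof -
  \<comment> \<open>The weight of cutting off a palindromic prefix of length \<open>j\<close> and
    continuing optimally. For an optimal first palindrome it equals \<open>t ^ pal_width w\<close>;
    the other lengths only enlarge the sum.\<close>
  define F where "F j w = (if palindrome (take j w) then t * t ^ pal_width (drop j w) else 0)"
    for j and w :: word
  have F_nonneg: "0 \<le> F j w" for j w
    using assms by (simp add: F_def)
  have "width_gf t n \<le> (\<Sum>w | length w = n. \<Sum>j=1..n. F j w)"
    unfolding width_gf_def
  proof (rule sum_mono)
    fix w :: word assume "w \<in> {w. length w = n}"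
    then have "w \<noteq> []" "length w = n"
      using assms by auto
    then obtain p v where p: "w = p @ v" "p \<noteq> []" "palindrome p" "pal_width w = Suc (pal_width v)"
      using pal_width_first_palindrome by blast
    have "t ^ pal_width w = F (length p) w"
      using p by (simp add: F_def)
    also have "\<dots> \<le> (\<Sum>j=1..n. F j w)"
      using p \<open>length w = n\<close> F_nonneg by (intro member_le_sum) (auto simp: Suc_le_eq)
    finally show "t ^ pal_width w \<le> (\<Sum>j=1..n. F j w)" .
  qed
  also have "\<dots> = (\<Sum>j=1..n. \<Sum>w | length w = n. F j w)"
    by (rule sum.swap)
  also have "\<dots> \<le> (\<Sum>j=1..n. 2 ^ ((j + 1) div 2) * t * width_gf t (n - j))"
  proof (rule sum_mono)
    fix j assume "j \<in> {1..n}"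
    then have "(\<Sum>w | length w = n. F j w) =
        (\<Sum>u | length u = j. \<Sum>v | length v = n - j. F j (u @ v))"
      using sum_words_append[of "F j" j "n - j"] by simp
    also have "\<dots> = (\<Sum>u | length u = j. if palindrome u then t * width_gf t (n - j) else 0)"
      by (intro sum.cong) (auto simp: F_def width_gf_def sum_distrib_left)
    also have "\<dots> = real (card {u. length u = j \<and> palindrome u}) * (t * width_gf t (n - j))"
      by (simp add: sum.If_cases Int_def)
    also have "\<dots> \<le> 2 ^ ((j + 1) div 2) * (t * width_gf t (n - j))"
      using card_palindromes_le[of j] assms width_gf_nonneg
      by (intro mult_right_mono) (simp_all flip: of_nat_le_iff)
    finally show "(\<Sum>w | length w = n. F j w) \<le> 2 ^ ((j + 1) div 2) * t * width_gf t (n - j)"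
      by (simp add: mult.assoc)
  qed
  finally show ?thesis .
qed

text \<open>The terms for 2k+1 and 2k+2 share the factor 2^(k+1) and add up to 48/25 * (18/25)^k, a
  geometric series with sum 48/7.\<close>

lemma sum_palindromes_weight:
  "(\<Sum>j=1..n. 2 ^ ((j + 1) div 2) * (3 / 5) ^ j) \<le> (48 / 7 :: real)"
proof -
  let ?f = "\<lambda>j. 2 ^ ((j + 1) div 2) * (3 / 5) ^ j :: real"
  have closed: "(\<Sum>j=1..2 * k. ?f j) = 48 / 7 * (1 - (18 / 25) ^ k)" for k
  proof (induction k)
    case (Suc k)
    have "2 ^ k * (9 / 25 :: real) ^ k = (18 / 25) ^ k"
      by (simp flip: power_mult_distrib)
    then have "?f (Suc (2 * k)) + ?f (Suc (Suc (2 * k))) = 48 / 25 * (18 / 25) ^ k"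
      by (simp add: power_mult power2_eq_square)
    with Suc show ?case
      by (simp add: algebra_simps)
  qed simp
  have "(\<Sum>j=1..n. ?f j) \<le> (\<Sum>j=1..2 * n. ?f j)"
    by (intro sum_mono2) auto
  also have "\<dots> \<le> 48 / 7"
    unfolding closed by simp
  finally show ?thesis .
qed

text \<open>Since 7/48 is the reciprocal of 48/7, the recursion reproduces the bound without an
  extra factor.\<close>

lemma width_gf_bound: "width_gf (7 / 48) n \<le> (5 / 3) ^ n"
proof (induction n rule: less_induct)
  case (less n)
  show ?case
  proof (cases "n = 0")
    case False
    have "width_gf (7 / 48) n \<le>
        (\<Sum>j=1..n. 2 ^ ((j + 1) div 2) * (7 / 48) * width_gf (7 / 48) (n - j))"
      using False by (intro width_gf_le) auto
    also have "\<dots> \<le> (\<Sum>j=1..n. 2 ^ ((j + 1) div 2) * (7 / 48) * ((5 / 3) ^ n * (3 / 5) ^ j))"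
    proof (intro sum_mono mult_left_mono)
      fix j assume j: "j \<in> {1..n}"
      then have "(5 / 3 :: real) ^ n = (5 / 3) ^ (n - j) * (5 / 3) ^ j"
        by (simp flip: power_add)
      then have "(5 / 3) ^ n * (3 / 5) ^ j = (5 / 3 :: real) ^ (n - j)"
        by (simp flip: power_mult_distrib add: mult.assoc)
      with less[of "n - j"] j show "width_gf (7 / 48) (n - j) \<le> (5 / 3) ^ n * (3 / 5) ^ j"
        by auto
    qed auto
    also have "\<dots> = (5 / 3) ^ n * (7 / 48) * (\<Sum>j=1..n. 2 ^ ((j + 1) div 2) * (3 / 5) ^ j)"
      by (simp add: sum_distrib_left mult_ac)
    also have "\<dots> \<le> (5 / 3) ^ n * (7 / 48) * (48 / 7)"
      by (intro mult_left_mono sum_palindromes_weight) auto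
    finally show ?thesis
      by simp
  qed (simp add: width_gf_def)
qed

text \<open>Jensen's inequality for the convex function \<open>t ^ k\<close> of
  \<open>k\<close>.\<close>

lemma powr_Kbar_le:
  assumes "0 < t"
  shows "2 ^ n * t powr Kbar n \<le> width_gf t n"
proof -
  let ?m = "Kbar n"
  have sum_width: "(\<Sum>w | length w = n. real (pal_width w)) = 2 ^ n * ?m"
    by (simp add: Kbar_def)
  \<comment> \<open>The left side is the tangent line at the mean width; its linear terms cancel in
    the sum over all words.\<close>
  have "t powr ?m * (1 + (real k - ?m) * ln t) \<le> t ^ k" for k
  proof -
    have "t powr ?m * (1 + (real k - ?m) * ln t) \<le> t powr ?m * exp ((real k - ?m) * ln t)"
      by (intro mult_left_mono exp_ge_add_one_self) auto
    also have "\<dots> = t ^ k"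
      using assms by (simp add: powr_def algebra_simps flip: exp_add powr_realpow)
    finally show ?thesis .
  qed
  then have "(\<Sum>w | length w = n. t powr ?m * (1 + (real (pal_width w) - ?m) * ln t)) \<le> width_gf t n"
    unfolding width_gf_def by (intro sum_mono)
  moreover have "(\<Sum>w :: word | length w = n. t powr ?m * (1 + (real (pal_width w) - ?m) * ln t)) =
      2 ^ n * t powr ?m"
    by (simp add: sum.distrib sum_subtractf sum_width flip: sum_distrib_left sum_distrib_right)
  ultimately show ?thesis
    by simp
qed

lemma Kbar_lower_bound: "9 / 100 * real n \<le> Kbar n"
proof -
  have "2 ^ n * (7 / 48) powr Kbar n \<le> (5 / 3) ^ n"
    using powr_Kbar_le[of "7 / 48" n] width_gf_bound[of n] by linarith
  moreover have "(5 / 3 :: real) ^ n = 2 ^ n * (5 / 6) ^ n"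
    by (simp flip: power_mult_distrib)
  ultimately have "(7 / 48) powr Kbar n \<le> (5 / 6) ^ n"
    by simp
  then have "ln ((7 / 48) powr Kbar n) \<le> ln ((5 / 6) ^ n)"
    by (intro ln_mono) auto
  then have "Kbar n * ln (7 / 48) \<le> real n * ln (5 / 6)"
    by (simp add: ln_powr ln_realpow)
  then have *: "real n * ln (6 / 5) \<le> Kbar n * ln (48 / 7)"
    by (simp add: ln_div algebra_simps)
  \<comment> \<open>A comparison of rational powers shows that 9/100 is at most ln (6/5) / ln
    (48/7), with no numerical logarithms.\<close>
  have "ln ((48 / 7) ^ 9 :: real) \<le> ln ((6 / 5) ^ 100)"
    by (intro ln_mono) (simp_all add: field_simps)
  then have "9 / 100 * ln (48 / 7) \<le> ln (6 / 5 :: real)"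
    by (simp add: ln_realpow)
  then have "real n * (9 / 100 * ln (48 / 7)) \<le> real n * ln (6 / 5)"
    by (intro mult_left_mono) auto
  with * have "9 / 100 * real n * ln (48 / 7) \<le> Kbar n * ln (48 / 7)"
    by linarith
  then show ?thesis
    by (simp add: mult_le_cancel_right)
qed

section \<open>The average width for length 21\<close>

type_synonym history = "(letter \<times> nat) list"

text \<open>
  The number attached to a letter is the width of a factorization of the whole word whose first
  palindrome ends at that letter and which is optimal after it.
\<close>

fun history :: "word \<Rightarrow> history" where
  "history [] = []"
| "history (c # w) = (c, Suc (pal_width w)) # history w"

lemma history_eq_Cons_iff:
  "(c, x) # k = history v \<longleftrightarrow> (\<exists>v'. v = c # v' \<and> x = Suc (pal_width v') \<and> k = history v')"
  by (cases v) auto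

text \<open>The prefix \<open>p\<close> may be empty, so the history of \<open>w\<close> itself
  occurs. It stands at the head because prepending a letter extends it; the order of the other
  entries is immaterial.\<close>

definition frontier :: "word \<Rightarrow> history list \<Rightarrow> bool" where
  "frontier w es \<longleftrightarrow>
     hd es = history w \<and> set es = {history v |v. \<exists>p. palindrome p \<and> w = p @ v}"

text \<open>If a palindromic prefix \<open>q\<close> is followed by \<open>c\<close>, prepending
  \<open>c\<close> creates the prefix \<open>c # q @ [c]\<close>, and the entry loses its first
  letter.\<close>

fun matching_tails :: "letter \<Rightarrow> history list \<Rightarrow> history list" where
  "matching_tails c [] = []"
| "matching_tails c ([] # es) = matching_tails c es"
| "matching_tails c (((d, x) # k) # es) =
     (if d = c then k # matching_tails c es else matching_tails c es)"

text \<open>The accumulator \<open>m\<close> is to start with the cost of taking \<open>[c]\<close>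
  as first palindrome.\<close>

fun matching_min :: "letter \<Rightarrow> history list \<Rightarrow> nat \<Rightarrow> nat" where
  "matching_min c [] m = m"
| "matching_min c ([] # es) m = matching_min c es m"
| "matching_min c (((d, x) # k) # es) m = matching_min c es (if d = c then min x m else m)"

lemma set_matching_tails: "set (matching_tails c es) = {k. \<exists>x. (c, x) # k \<in> set es}"
  by (induction c es rule: matching_tails.induct) auto

lemma matching_min_le: "matching_min c es m \<le> m"
  by (induction c es m rule: matching_min.induct) (auto split: if_splits)

lemma matching_min_le_member: "(c, x) # k \<in> set es \<Longrightarrow> matching_min c es m \<le> x"
proof (induction c es m rule: matching_min.induct)
  case (3 c d y l es m)
  then show ?case
    using matching_min_le[of c es "min x m"] by auto
qed auto

lemma matching_min_cases:
  "matching_min c es m = m \<or> (\<exists>k. (c, matching_min c es m) # k \<in> set es)"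
proof (induction c es m rule: matching_min.induct)
  case (3 c d y l es m)
  then show ?case
    by (auto simp: min_def split: if_splits)
qed auto

text \<open>The first palindrome is \<open>[c]\<close>, covered by the starting value, or
  \<open>c # q @ [c]\<close>, covered by the entry left after \<open>q\<close>, whose first number
  already counts this palindrome.\<close>

lemma matching_min_frontier:
  assumes "frontier w es"
  shows "matching_min c es (Suc (pal_width w)) = pal_width (c # w)"
proof (rule antisym)
  obtain p v where p: "c # w = p @ v" "p \<noteq> []" "palindrome p"
    "pal_width (c # w) = Suc (pal_width v)"
    using pal_width_first_palindrome[of "c # w"] by blast
  from \<open>palindrome p\<close> show "matching_min c es (Suc (pal_width w)) \<le> pal_width (c # w)"
  proof (cases rule: palindrome_snoc_cases)
    case (2 d)
    then show ?thesis
      using p matching_min_le[of c es] by simp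
  next
    case (3 d q)
    then have "w = q @ c # v"
      using p by simp
    with assms \<open>palindrome q\<close> have "history (c # v) \<in> set es"
      unfolding frontier_def by blast
    then show ?thesis
      using p matching_min_le_member[of c "Suc (pal_width v)" "history v" es] by simp
  qed (use p in simp)
  let ?x = "matching_min c es (Suc (pal_width w))"
  from matching_min_cases[of c es "Suc (pal_width w)"] show "pal_width (c # w) \<le> ?x"
  proof
    assume "?x = Suc (pal_width w)"
    then show ?thesis
      using pal_width_palindrome_append_le[of "[c]" w] by (simp add: palindrome_iff_rev)
  next
    assume "\<exists>k. (c, ?x) # k \<in> set es"
    then obtain p v where p: "palindrome p" "w = p @ c # v" "?x = Suc (pal_width v)"
      using assms unfolding frontier_def by (auto simp: history_eq_Cons_iff)
    then show ?thesis
      using pal_width_palindrome_append_le[of "c # p @ [c]" v] by (simp add: palindrome_iff_rev)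
  qed
qed

lemma frontier_Nil: "frontier [] [[]]"
  by (auto simp: frontier_def palindrome_iff_rev)

text \<open>The three parts of the new list belong to the prefixes \<open>[]\<close>,
  \<open>[c]\<close> and \<open>c # q @ [c]\<close>, in this order.\<close>

lemma frontier_Cons:
  assumes "frontier w es"
  shows "frontier (c # w) (history (c # w) # history w # matching_tails c es)"
proof -
  have split: "(\<exists>p. palindrome p \<and> c # w = p @ v) \<longleftrightarrow>
      v = c # w \<or> v = w \<or> (\<exists>p. palindrome p \<and> w = p @ c # v)" (is "?L \<longleftrightarrow> ?R") for v
  proof
    assume ?L
    then obtain p where p: "palindrome p" "c # w = p @ v"
      by blast
    from \<open>palindrome p\<close> show ?R
      by (cases rule: palindrome_snoc_cases) (use p in auto)
  next
    assume ?R
    then consider "v = c # w" | "v = w" | p where "palindrome p" "w = p @ c # v"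
      by blast
    then show ?L
    proof cases
      case 1
      then show ?thesis
        by (intro exI[of _ "[]"]) (simp add: palindrome_iff_rev)
    next
      case 2
      then show ?thesis
        by (intro exI[of _ "[c]"]) (simp add: palindrome_iff_rev)
    next
      case (3 p)
      then show ?thesis
        by (intro exI[of _ "c # p @ [c]"]) (simp add: palindrome_iff_rev)
    qed
  qed
  have "{history v |v. \<exists>p. palindrome p \<and> c # w = p @ v} =
      {history (c # w), history w} \<union> {history v |v. \<exists>p. palindrome p \<and> w = p @ c # v}"
    unfolding split by blast
  moreover have "set (matching_tails c es) = {history v |v. \<exists>p. palindrome p \<and> w = p @ c # v}"
  proof -
    have "set es = {history v |v. \<exists>p. palindrome p \<and> w = p @ v}"
      using assms by (simp add: frontier_def)
    then have "set (matching_tails c es) =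
        {k. \<exists>x v. (c, x) # k = history v \<and> (\<exists>p. palindrome p \<and> w = p @ v)}"
      unfolding set_matching_tails by blast
    also have "\<dots> = {history v |v. \<exists>p. palindrome p \<and> w = p @ c # v}"
      unfolding history_eq_Cons_iff by blast
    finally show ?thesis .
  qed
  ultimately show ?thesis
    unfolding frontier_def by simp
qed

text \<open>Here \<open>g\<close> stands for the current width plus one, which is the number stored
  with the next letter. Hence the leaves add up widths plus one.\<close>

fun width_total :: "nat \<Rightarrow> history list \<Rightarrow> nat \<Rightarrow> nat" where
  "width_total 0 es g = g"
| "width_total (Suc n) es g =
     width_total n (((Letter_a, g) # hd es) # hd es # matching_tails Letter_a es)
       (Suc (matching_min Letter_a es g)) +
     width_total n (((Letter_b, g) # hd es) # hd es # matching_tails Letter_b es)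
       (Suc (matching_min Letter_b es g))"

lemma width_total_frontier:
  "frontier w es \<Longrightarrow>
    width_total n es (Suc (pal_width w)) = (\<Sum>v | length v = n. Suc (pal_width (v @ w)))"
proof (induction n arbitrary: w es)
  case (Suc n)
  have "width_total n (((c, Suc (pal_width w)) # hd es) # hd es # matching_tails c es)
      (Suc (matching_min c es (Suc (pal_width w)))) =
      (\<Sum>v | length v = n. Suc (pal_width (v @ c # w)))" for c
    using Suc.IH[OF frontier_Cons[OF Suc.prems, of c]] Suc.prems
    by (simp add: matching_min_frontier frontier_def)
  then show ?case
    by (simp add: sum_words_snoc)
qed simp

text \<open>
  The rules below are unconditional, and the two for \<open>width_total\<close> do not overlap in
  \<open>width_total_simps\<close>, so that no new histories are built for the last letter.
\<close>

lemma width_total_Suc_Cons: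
  "width_total (Suc n) (h # es) g =
     width_total n (((Letter_a, g) # h) # h # matching_tails Letter_a (h # es))
       (1 + matching_min Letter_a (h # es) g) +
     width_total n (((Letter_b, g) # h) # h # matching_tails Letter_b (h # es))
       (1 + matching_min Letter_b (h # es) g)"
  by simp

lemma width_total_one:
  "width_total (Suc 0) es g = (1 + matching_min Letter_a es g) + (1 + matching_min Letter_b es g)"
  by simp

lemma matching_tails_eval:
  "matching_tails c [] = []"
  "matching_tails c ([] # es) = matching_tails c es"
  "matching_tails Letter_a (((Letter_a, x) # k) # es) = k # matching_tails Letter_a es"
  "matching_tails Letter_a (((Letter_b, x) # k) # es) = matching_tails Letter_a es"
  "matching_tails Letter_b (((Letter_a, x) # k) # es) = matching_tails Letter_b es"
  "matching_tails Letter_b (((Letter_b, x) # k) # es) = k # matching_tails Letter_b es"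
  by simp_all

lemma matching_min_eval:
  "matching_min c [] m = m"
  "matching_min c ([] # es) m = matching_min c es m"
  "matching_min Letter_a (((Letter_a, x) # k) # es) m = matching_min Letter_a es (min x m)"
  "matching_min Letter_a (((Letter_b, x) # k) # es) m = matching_min Letter_a es m"
  "matching_min Letter_b (((Letter_a, x) # k) # es) m = matching_min Letter_b es m"
  "matching_min Letter_b (((Letter_b, x) # k) # es) m = matching_min Letter_b es (min x m)"
  by simp_all

lemmas numeral_eval =
  add_num_simps numeral_plus_numeral one_plus_numeral numeral_plus_one one_add_one
  min_def order.refl le_num_simps less_num_simps numeral_le_iff numeral_le_one_iff one_le_numeral
  if_True if_False

lemmas width_total_simps =
  width_total_one width_total_Suc_Cons[of "Suc n" for n] matching_tails_eval matching_min_eval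
  numeral_eval

text \<open>The depth is unary to match the recursion on \<open>Suc\<close>, while the widths stay
  binary numerals.\<close>

lemma eighteen_eq_Suc:
  "18 = Suc (Suc (Suc (Suc (Suc (Suc (Suc (Suc (Suc (Suc (Suc (Suc (Suc (Suc (Suc (Suc (Suc
    (Suc 0)))))))))))))))))"
  by simp

text \<open>The computation is split over the four words of length 3 ending in
  \<open>Letter_a\<close>. Each list is the frontier of the word in the lemma's name, and the last
  argument is its width plus one.\<close>

lemma width_total_aaa:
  "width_total 18
     [[(Letter_a, 2), (Letter_a, 2), (Letter_a, 1)],
      [(Letter_a, 2), (Letter_a, 1)], [(Letter_a, 1)], []]
     2 = 1364369"
  unfolding eighteen_eq_Suc by (simp only: width_total_simps)

lemma width_total_baa:
  "width_total 18
     [[(Letter_b, 2), (Letter_a, 2), (Letter_a, 1)],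
      [(Letter_a, 2), (Letter_a, 1)]]
     3 = 1396693"
  unfolding eighteen_eq_Suc by (simp only: width_total_simps)

lemma width_total_aba:
  "width_total 18
     [[(Letter_a, 3), (Letter_b, 2), (Letter_a, 1)],
      [(Letter_b, 2), (Letter_a, 1)], []]
     2 = 1382037"
  unfolding eighteen_eq_Suc by (simp only: width_total_simps)

lemma width_total_bba:
  "width_total 18
     [[(Letter_b, 3), (Letter_b, 2), (Letter_a, 1)],
      [(Letter_b, 2), (Letter_a, 1)], [(Letter_a, 1)]]
     3 = 1375321"
  unfolding eighteen_eq_Suc by (simp only: width_total_simps)

lemma width_total_20: "width_total 20 [[(Letter_a, 1)], []] 2 = 5518420"
proof -
  have *: "20 = Suc (Suc 18)"
    by simp
  show ?thesis
    unfolding *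
    by (simp only: width_total_Suc_Cons matching_tails_eval matching_min_eval numeral_eval
        width_total_aaa width_total_baa width_total_aba width_total_bba)
qed

fun swap_letter :: "letter \<Rightarrow> letter" where
  "swap_letter Letter_a = Letter_b"
| "swap_letter Letter_b = Letter_a"

lemma swap_letter_swap_letter [simp]: "swap_letter (swap_letter c) = c"
  by (cases c) auto

lemma swap_letter_comp [simp]: "swap_letter \<circ> swap_letter = id"
  by auto

lemma pal_width_map_swap_letter: "pal_width (map swap_letter w) = pal_width w"
  using pal_width_map_le[of swap_letter w] pal_width_map_le[of swap_letter "map swap_letter w"]
  by simp

lemma sum_pal_width_21: "(\<Sum>w | length w = 21. pal_width w) = 8939688"
proof -
  let ?s = "\<lambda>c. \<Sum>v | length v = 20. pal_width (v @ [c])"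
  \<comment> \<open>Swapping the letters exchanges the two possible last letters and keeps the
    width, so one half of the words suffices.\<close>
  have "bij_betw (map swap_letter) {v. length v = 20} {v. length v = 20}"
    by (rule bij_betw_byWitness[where f' = "map swap_letter"]) auto
  from sum.reindex_bij_betw[OF this, of "\<lambda>v. pal_width (v @ [Letter_b])"]
  have "?s Letter_b = (\<Sum>v | length v = 20. pal_width (map swap_letter (v @ [Letter_a])))"
    by simp
  then have swap: "?s Letter_b = ?s Letter_a"
    by (simp only: pal_width_map_swap_letter)
  have width_a: "Suc (pal_width [Letter_a]) = 2"
    using matching_min_frontier[OF frontier_Nil, of Letter_a] by simp
  have "frontier [Letter_a] [[(Letter_a, 1)], []]"
    using frontier_Cons[OF frontier_Nil, of Letter_a] by simp
  from width_total_frontier[OF this, of 20, unfolded width_a width_total_20]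
  have "(\<Sum>v | length v = 20. Suc (pal_width (v @ [Letter_a]))) = 5518420"
    by simp
  \<comment> \<open>Each of the 2^20 words contributed an extra one through
    \<open>Suc\<close>.\<close>
  then have "?s Letter_a + 2 ^ 20 = 5518420"
    by (simp add: sum_Suc)
  then have "?s Letter_a = 4469844"
    by simp
  with swap sum_words_snoc[of pal_width 20] show ?thesis
    by simp
qed

theorem theorem2:
  shows "\<exists>K :: real.
     (\<lambda>n. Kbar n / real n) \<longlonglongrightarrow> K \<and>
     K = (INF n \<in> {1..}. Kbar n / real n) \<and>
     0.08781 < K \<and>
     K \<le> Kbar 21 / 21 \<and>
     Kbar 21 / 21 = 372487 / (7 * 2 ^ 18) \<and>
     \<bar>372487 / (7 * 2 ^ 18) - 0.2030 :: real\<bar> \<le> 0.00005"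
proof -
  let ?K = "INF n \<in> {1..}. Kbar n / real n"
  have "9 / 100 \<le> ?K"
  proof (rule cINF_greatest)
    fix n :: nat assume "n \<in> {1..}"
    then show "9 / 100 \<le> Kbar n / real n"
      using Kbar_lower_bound[of n] by (simp add: pos_le_divide_eq)
  qed simp
  \<comment> \<open>An infimum preserves only the weak bound; strictness comes from the gap between
    0.08781 and 0.09.\<close>
  then have "0.08781 < ?K"
    by simp
  moreover have "?K \<le> Kbar 21 / real 21"
    using Kbar_nonneg by (intro cINF_lower bdd_belowI2[of _ 0]) auto
  \<comment> \<open>After division by 21 the factor 24 cancels, as 8939688 = 24 * 372487.\<close>
  moreover have "Kbar 21 = 8939688 / 2 ^ 21"
    unfolding Kbar_def using sum_pal_width_21 by (simp flip: of_nat_sum)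
  ultimately show ?thesis
    using Fekete[OF Kbar_subadditive Kbar_nonneg]
    by (intro exI[of _ ?K]) (simp add: field_simps)
qed

end
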